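(* For all integers $m,n\ge 2$, $\gamma_I(C_m \otimes C_n) = \left\lceil \frac{mn}{2}\right\rceil$.
   Context: For an integer $k\ge 2$, $C_k$ denotes the directed cycle with vertex set $\{1,2,\dots,k\}$ and arcs $i\rightarrow i+1$ (indices taken modulo $k$). For digraphs $D_1=(V_1,A_1)$ and $D_2=(V_2,A_2)$, the strong product $D_1\otimes D_2$ is the digraph with vertex set $V_1\times V_2$ in which $(x_1,x_2)\rightarrow(y_1,y_2)$ is an arc if and only if one of the following holds: ($x_1\rightarrow y_1$ in $D_1$ and $x_2\rightarrow y_2$ in $D_2$); ($x_1=y_1$ and $x_2\rightarrow y_2$ in $D_2$); ($x_1\rightarrow y_1$ in $D_1$ and $x_2=y_2$). An Italian dominating function on a digraph $D$ is a function $f:V(D)\to\{0,1,2\}$ such that every vertex $v$ with $f(v)=0$ has at least two in-neighbors $u$ with $f(u)=1$ or at least one in-neighbor $w$ with $f(w)=2$ (an in-neighbor of $v$ is a vertex $u$ with $u\rightarrow v$). Its weight is $\sum_{u\in V(D)} f(u)$, and the Italian domination number $\gamma_I(D)$ is the minimum weight of an Italian dominating function on $D$. *)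

theory Defs
  imports Complex_Main "Graph_Theory.Pair_Digraph"
begin

definition dicycle :: "nat \<Rightarrow> nat pair_pre_digraph" where
  "dicycle k = \<lparr> pverts = {1..k}, parcs = {(i, i mod k + 1) | i. i \<in> {1..k}} \<rparr>"

definition strong_product ::
  "'a pair_pre_digraph \<Rightarrow> 'b pair_pre_digraph \<Rightarrow> ('a \<times> 'b) pair_pre_digraph"
  (infixl \<open>\<otimes>\<^sub>S\<close> 70) where
  "D1 \<otimes>\<^sub>S D2 =
    \<lparr> pverts = pverts D1 \<times> pverts D2,
      parcs = {((x1, x2), (y1, y2)) | x1 x2 y1 y2.
        x1 \<in> pverts D1 \<and> y1 \<in> pverts D1 \<and> x2 \<in> pverts D2 \<and> y2 \<in> pverts D2 \<and>
        ((x1, y1) \<in> parcs D1 \<and> (x2, y2) \<in> parcs D2 \<or>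
         x1 = y1 \<and> (x2, y2) \<in> parcs D2 \<or>
         (x1, y1) \<in> parcs D1 \<and> x2 = y2)} \<rparr>"

definition in_neighbors :: "'a pair_pre_digraph \<Rightarrow> 'a \<Rightarrow> 'a set" where
  "in_neighbors D v = {u \<in> pverts D. (u, v) \<in> parcs D}"

text \<open>The values of \<open>f\<close> outside the vertex set are unconstrained and irrelevant.\<close>

definition italian_dominating :: "'a pair_pre_digraph \<Rightarrow> ('a \<Rightarrow> nat) \<Rightarrow> bool" where
  "italian_dominating D f \<longleftrightarrow>
    (\<forall>v \<in> pverts D. f v \<in> {0, 1, 2}) \<and>
    (\<forall>v \<in> pverts D. f v = 0 \<longrightarrow>
      (\<exists>u \<in> in_neighbors D v. \<exists>u' \<in> in_neighbors D v. u \<noteq> u' \<and> f u = 1 \<and> f u' = 1) \<or>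
      (\<exists>w \<in> in_neighbors D v. f w = 2))"

definition weight :: "'a pair_pre_digraph \<Rightarrow> ('a \<Rightarrow> nat) \<Rightarrow> nat" where
  "weight D f = (\<Sum>u \<in> pverts D. f u)"

text \<open>Meaningful for finite \<open>D\<close> only. The minimum ranges over a nonempty set, since the
  constant function \<open>1\<close> is always Italian dominating.\<close>

definition italian_domination_number :: "'a pair_pre_digraph \<Rightarrow> nat" (\<open>\<gamma>\<^sub>I\<close>) where
  "\<gamma>\<^sub>I D = (LEAST w. \<exists>f. italian_dominating D f \<and> w = weight D f)"

lemma italian_domination_number_attained:
  "\<exists>f. italian_dominating D f \<and> \<gamma>\<^sub>I D = weight D f"
proof -
  have "italian_dominating D (\<lambda>_. 1)"
    by (simp add: italian_dominating_def)
  then have "\<exists>w f. italian_dominating D f \<and> w = weight D f"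
    by blast
  then show ?thesis
    unfolding italian_domination_number_def by (rule LeastI_ex)
qed

lemma italian_domination_number_le:
  "italian_dominating D f \<Longrightarrow> \<gamma>\<^sub>I D \<le> weight D f"
  unfolding italian_domination_number_def by (rule Least_le) blast

lemma pair_fin_digraph_dicycle: "pair_fin_digraph (dicycle k)"
proof
  show "finite (parcs (dicycle k))"
    by (rule finite_subset[of _ "(\<lambda>i. (i, i mod k + 1)) ` {1..k}"]) (auto simp: dicycle_def)
qed (auto simp: dicycle_def Suc_le_eq)

lemma pair_fin_digraph_strong_product:
  assumes "pair_fin_digraph D1" "pair_fin_digraph D2"
  shows "pair_fin_digraph (D1 \<otimes>\<^sub>S D2)"
proof -
  interpret D1: pair_fin_digraph D1 by fact
  interpret D2: pair_fin_digraph D2 by fact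
  show ?thesis
  proof
    show "finite (parcs (D1 \<otimes>\<^sub>S D2))"
      by (rule finite_subset[of _ "(pverts D1 \<times> pverts D2) \<times> (pverts D1 \<times> pverts D2)"])
         (auto simp: strong_product_def)
  qed (auto simp: strong_product_def)
qed

end

theory Submission
  imports Defs
begin

text \<open>
  Lower bound: any two cyclically consecutive rows together have weight at least \<open>n\<close>. Indeed, if
  column \<open>j\<close> carries no weight in rows \<open>i - 1\<close> and \<open>i\<close>, then the vertex \<open>(i, j)\<close> receives its
  weight 2 from column \<open>j - 1\<close> of these two rows, so each empty column is compensated by its
  predecessor. Upper bound: the checkerboard function, equal to 1 where \<open>i + j\<close> is even, is Italian
  dominating for all parities of \<open>m\<close> and \<open>n\<close>.
\<close>

definition cycle_pred :: "nat \<Rightarrow> nat \<Rightarrow> nat" where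
  "cycle_pred k i = (if i = 1 then k else i - 1)"

lemma cycle_pred_in: "i \<in> {1..k} \<Longrightarrow> cycle_pred k i \<in> {1..k}"
  by (auto simp: cycle_pred_def)

lemma cycle_pred_neq: "k \<ge> 2 \<Longrightarrow> i \<in> {1..k} \<Longrightarrow> cycle_pred k i \<noteq> i"
  by (auto simp: cycle_pred_def)

lemma bij_betw_cycle_pred: "bij_betw (cycle_pred k) {1..k} {1..k}"
proof (rule bij_betwI')
  show "\<exists>x\<in>{1..k}. y = cycle_pred k x" if "y \<in> {1..k}" for y
    using that by (intro bexI[of _ "if y = k then 1 else y + 1"]) (auto simp: cycle_pred_def)
qed (auto simp: cycle_pred_def split: if_splits)

lemma arc_dicycle_iff:
  assumes "i \<in> {1..k}"
  shows "(x, i) \<in> parcs (dicycle k) \<longleftrightarrow> x = cycle_pred k i"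
proof
  assume "(x, i) \<in> parcs (dicycle k)"
  then have "x \<in> {1..k}" "i = x mod k + 1"
    by (auto simp: dicycle_def)
  then show "x = cycle_pred k i"
    by (cases "x = k") (auto simp: cycle_pred_def)
next
  assume "x = cycle_pred k i"
  then show "(x, i) \<in> parcs (dicycle k)"
    using assms by (auto simp: dicycle_def cycle_pred_def)
qed

lemma in_neighbors_torus:
  assumes "i \<in> {1..m}" "j \<in> {1..n}"
  shows "in_neighbors (dicycle m \<otimes>\<^sub>S dicycle n) (i, j) =
    {(cycle_pred m i, cycle_pred n j), (i, cycle_pred n j), (cycle_pred m i, j)}"
proof -
  have "pverts (dicycle k) = {1..k}" for k
    by (simp add: dicycle_def)
  then show ?thesis
    using assms cycle_pred_in[OF assms(1)] cycle_pred_in[OF assms(2)]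
      arc_dicycle_iff[OF assms(1)] arc_dicycle_iff[OF assms(2)]
    unfolding in_neighbors_def strong_product_def by auto
qed

lemma pverts_torus: "pverts (dicycle m \<otimes>\<^sub>S dicycle n) = {1..m} \<times> {1..n}"
  by (simp add: strong_product_def dicycle_def)

lemma weight_torus:
  "weight (dicycle m \<otimes>\<^sub>S dicycle n) f = (\<Sum>i\<in>{1..m}. \<Sum>j\<in>{1..n}. f (i, j))"
  by (simp add: weight_def pverts_torus sum.cartesian_product)

text \<open>Merges the two ways of dominating a vertex into one inequality that can be
  summed.\<close>

lemma italian_dominating_torus_in_weight:
  assumes "italian_dominating (dicycle m \<otimes>\<^sub>S dicycle n) f"
    and "i \<in> {1..m}" "j \<in> {1..n}" "f (i, j) = 0"
  shows "f (cycle_pred m i, cycle_pred n j) + f (i, cycle_pred n j) + f (cycle_pred m i, j) \<ge> 2"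
proof -
  have "(i, j) \<in> pverts (dicycle m \<otimes>\<^sub>S dicycle n)"
    using assms by (simp add: pverts_torus)
  with assms show ?thesis
    unfolding italian_dominating_def
    by (force simp: in_neighbors_torus simp del: One_nat_def)
qed

text \<open>Discharging: each entry that is at least 2 passes one unit to its cyclic successor, and
  \<open>d\<close> marks the donors. Afterwards every position holds at least 1, and the total is
  unchanged.\<close>

lemma sum_cyclic_ge:
  fixes c :: "nat \<Rightarrow> nat"
  assumes "\<And>j. j \<in> {1..n} \<Longrightarrow> c j = 0 \<Longrightarrow> c (cycle_pred n j) \<ge> 2"
  shows "(\<Sum>j\<in>{1..n}. c j) \<ge> n"
proof -
  define d where "d j = (if c j \<ge> 2 then 1 else 0 :: nat)" for j
  have "n + (\<Sum>j\<in>{1..n}. d j) = (\<Sum>j\<in>{1..n}. 1 + d j)"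
    by (simp only: sum.distrib) simp
  also have "\<dots> \<le> (\<Sum>j\<in>{1..n}. c j + d (cycle_pred n j))"
    using assms by (intro sum_mono) (fastforce simp: d_def)
  also have "\<dots> = (\<Sum>j\<in>{1..n}. c j) + (\<Sum>j\<in>{1..n}. d j)"
    using sum.reindex_bij_betw[OF bij_betw_cycle_pred, of d n] by (simp add: sum.distrib)
  finally show ?thesis
    by simp
qed

lemma weight_torus_ge:
  assumes "italian_dominating (dicycle m \<otimes>\<^sub>S dicycle n) f"
  shows "m * n \<le> 2 * weight (dicycle m \<otimes>\<^sub>S dicycle n) f"
proof -
  define r where "r i = (\<Sum>j\<in>{1..n}. f (i, j))" for i
  have "n \<le> r i + r (cycle_pred m i)" if "i \<in> {1..m}" for i
    unfolding r_def sum.distrib[symmetric]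
    \<comment> \<open>Applied to the column sums of the two rows. In an empty column the third term
      of the in-weight bound vanishes, so the other two, both in the preceding column, sum to at
      least 2.\<close>
    by (rule sum_cyclic_ge) (use italian_dominating_torus_in_weight[OF assms that] in force)
  then have "(\<Sum>i\<in>{1..m}. n) \<le> (\<Sum>i\<in>{1..m}. r i + r (cycle_pred m i))"
    by (rule sum_mono)
  also have "\<dots> = 2 * (\<Sum>i\<in>{1..m}. r i)"
    using sum.reindex_bij_betw[OF bij_betw_cycle_pred, of r m] by (simp add: sum.distrib)
  finally show ?thesis
    by (simp add: weight_torus r_def)
qed

definition checkerboard :: "nat \<times> nat \<Rightarrow> nat" where
  "checkerboard = (\<lambda>(i, j). if even (i + j) then 1 else 0)"

text \<open>A step back in one coordinate flips the parity of the sum unless it wraps around an odd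
  cycle; in that case the diagonal in-neighbor is even instead.\<close>

lemma italian_dominating_checkerboard:
  assumes "m \<ge> 2" "n \<ge> 2"
  shows "italian_dominating (dicycle m \<otimes>\<^sub>S dicycle n) checkerboard"
proof -
  have "\<exists>u \<in> in_neighbors (dicycle m \<otimes>\<^sub>S dicycle n) (i, j).
      \<exists>u' \<in> in_neighbors (dicycle m \<otimes>\<^sub>S dicycle n) (i, j).
        u \<noteq> u' \<and> checkerboard u = 1 \<and> checkerboard u' = 1"
    if ij: "i \<in> {1..m}" "j \<in> {1..n}" and "checkerboard (i, j) = 0" for i j
  proof -
    have odd: "odd (i + j)"
      using that by (auto simp: checkerboard_def split: if_splits)
    let ?p = "cycle_pred m i" and ?q = "cycle_pred n j"
    \<comment> \<open>This is where lengths at least 2 matter: the three in-neighbors are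
      distinct.\<close>
    have neq: "?p \<noteq> i" "?q \<noteq> j"
      using cycle_pred_neq assms ij by auto
    \<comment> \<open>As \<open>i\<close> and \<open>j\<close> have opposite parities, at most one of them equals 1, so at most one of the
      two predecessor steps wraps around, possibly without changing the parity.\<close>
    consider "even (?p + j)" "even (i + ?q)" | "even (?p + ?q)" "even (i + ?q)"
      | "even (?p + ?q)" "even (?p + j)"
      using odd ij by (cases "i = 1"; cases "j = 1") (auto simp: cycle_pred_def)
    then show ?thesis
      unfolding in_neighbors_torus[OF ij] using neq by cases (auto simp: checkerboard_def)
  qed
  then show ?thesis
    unfolding italian_dominating_def pverts_torus by (auto simp: checkerboard_def)
qed

text \<open>Writing the parity indicator with signs makes the double sum factor. Each sign sum is 0
  or -1, so their product is at most 1, with equality when \<open>m\<close> and \<open>n\<close> are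
  both odd.\<close>

lemma weight_checkerboard_le:
  "2 * weight (dicycle m \<otimes>\<^sub>S dicycle n) checkerboard \<le> m * n + 1"
proof -
  define s :: "nat \<Rightarrow> int" where "s k = (\<Sum>i\<in>{1..k}. (-1) ^ i)" for k
  have s: "s k = (if even k then 0 else -1)" for k
    unfolding s_def by (induction k) auto
  have "2 * int (checkerboard (i, j)) = 1 + (-1) ^ i * (-1) ^ j" for i j
    by (simp add: checkerboard_def flip: power_add)
  then have "2 * int (weight (dicycle m \<otimes>\<^sub>S dicycle n) checkerboard) =
      (\<Sum>i\<in>{1..m}. \<Sum>j\<in>{1..n}. 1 + (-1) ^ i * (-1) ^ j)"
    by (simp add: weight_torus sum_distrib_left)
  also have "\<dots> = int (m * n) + s m * s n"
    by (simp add: sum.distrib s_def sum_product)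
  also have "\<dots> \<le> int (m * n + 1)"
    by (simp add: s)
  finally show ?thesis
    by linarith
qed

theorem theorem2p5:
  fixes m n :: nat
  assumes "m \<ge> 2" and "n \<ge> 2"
  shows "int (\<gamma>\<^sub>I (dicycle m \<otimes>\<^sub>S dicycle n)) = \<lceil>real (m * n) / 2\<rceil>"
proof -
  let ?D = "dicycle m \<otimes>\<^sub>S dicycle n"
  have "m * n \<le> 2 * \<gamma>\<^sub>I ?D"
    using italian_domination_number_attained[of ?D] weight_torus_ge by metis
  moreover have "2 * \<gamma>\<^sub>I ?D \<le> m * n + 1"
    using italian_domination_number_le[OF italian_dominating_checkerboard[OF assms]]
      weight_checkerboard_le[of m n] by linarith
  ultimately have "real (m * n) \<le> 2 * real (\<gamma>\<^sub>I ?D)" "2 * real (\<gamma>\<^sub>I ?D) \<le> real (m * n) + 1"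
    by linarith+
  then show ?thesis
    by (intro ceiling_unique[symmetric]) auto
qed

end
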